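(* Let $n\ge 1$, let $C_1,\dots,C_n\subset\mathbb{R}^d$ be nonempty closed convex sets, and let $x_0\in\mathbb{R}^d$. Define $$x_{k+1}=\frac1n\sum_{i=1}^n P_{C_i}(x_k),\qquad\forall k\ge 0.$$ Then the sequence $\{x_k\}_{k\ge 0}$ is self-contracted.
   Context: $\mathbb{R}^d$ is the $d$-dimensional Euclidean space with norm $\|\cdot\|$. $P_C$ denotes the metric projection onto a nonempty closed convex set $C$. A sequence $\{x_k\}$ in $\mathbb{R}^d$ is called self-contracted if for all indices $k_1\le k_2\le k_3$ one has $\|x_{k_3}-x_{k_2}\|\le\|x_{k_3}-x_{k_1}\|$. *)

theory Defs
  imports "HOL-Analysis.Analysis"
begin

definition self_contracted :: "(nat \<Rightarrow> 'a::real_normed_vector) \<Rightarrow> bool" where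
  "self_contracted x \<longleftrightarrow>
     (\<forall>k1 k2 k3. k1 \<le> k2 \<longrightarrow> k2 \<le> k3 \<longrightarrow> norm (x k3 - x k2) \<le> norm (x k3 - x k1))"

end

theory Submission
  imports Defs
begin

text \<open>
  The iteration is gradient descent with unit step for the convex function
  \<open>f z = (1 / (2 * n)) * (\<Sum>i. (dist z (C i))\<^sup>2)\<close>, whose gradient at \<open>z\<close> is \<open>z - T z\<close>
  with \<open>T z\<close> the average of the projections. With \<open>g = x k - x (Suc k)\<close>, the descent estimate
  \<open>f (T z) \<le> f z - (norm (z - T z))\<^sup>2 / 2\<close> gives \<open>f (x k) - f (x m) \<ge> (norm g)\<^sup>2 / 2\<close>
  for \<open>m > k\<close>, and the gradient inequality at \<open>x k\<close> then gives
  \<open>- 2 * (g \<bullet> (x m - x k)) \<ge> (norm g)\<^sup>2\<close>, which is exactly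
  \<open>norm (x m - x (Suc k)) \<le> norm (x m - x k)\<close>.
\<close>

text \<open>Consecutive indices suffice: with the last index fixed, the one-step inequalities chain
  as the middle index climbs from \<open>k1\<close> to \<open>k2\<close>.\<close>

lemma self_contractedI:
  fixes x :: "nat \<Rightarrow> 'a::real_normed_vector"
  assumes "\<And>k m. k < m \<Longrightarrow> norm (x m - x (Suc k)) \<le> norm (x m - x k)"
  shows "self_contracted x"
  unfolding self_contracted_def
proof (intro allI impI)
  fix k1 k2 k3 :: nat
  assume "k1 \<le> k2" "k2 \<le> k3"
  then show "norm (x k3 - x k2) \<le> norm (x k3 - x k1)"
  proof (induction k2 rule: dec_induct)
    case (step j)
    then show ?case
      using assms[of j k3] by simp
  qed simp
qed

lemma self_contracted_gradient_descent:
  fixes x :: "nat \<Rightarrow> 'a::real_inner"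
  assumes grad: "\<And>k m. F (x m) \<ge> F (x k) + (x k - x (Suc k)) \<bullet> (x m - x k)"
    and descent: "\<And>k. F (x (Suc k)) \<le> F (x k) - (norm (x k - x (Suc k)))\<^sup>2 / 2"
  shows "self_contracted x"
proof (rule self_contractedI)
  fix k m :: nat
  assume "k < m"
  have "F (x (Suc j)) \<le> F (x j)" for j
    using descent[of j] zero_le_power2[of "norm (x j - x (Suc j))"] by linarith
  \<comment> \<open>Monotonicity is used only from \<open>Suc k\<close> on, so the decrease gained
    at step \<open>k\<close> is kept in full.\<close>
  then have "F (x m) \<le> F (x (Suc k))"
    using lift_Suc_antimono_le[of "\<lambda>j. F (x j)" "Suc k" m] \<open>k < m\<close> by simp
  then have "(norm (x k - x (Suc k)))\<^sup>2 \<le> - 2 * ((x k - x (Suc k)) \<bullet> (x m - x k))"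
    using descent[of k] grad[of k m] by linarith
  then have "(norm (x m - x (Suc k)))\<^sup>2 \<le> (norm (x m - x k))\<^sup>2"
    by (simp add: power2_norm_eq_inner inner_diff_left inner_diff_right inner_commute)
  then show "norm (x m - x (Suc k)) \<le> norm (x m - x k)"
    by (rule power2_le_imp_le) simp
qed

text \<open>With \<open>p\<close>, \<open>q\<close> the projections of \<open>x\<close>,
  \<open>y\<close>, left minus right is the squared norm of \<open>(y - q) - (x - p)\<close> minus
  \<open>2 * ((x - p) \<bullet> (q - p))\<close>, and that inner product is nonpositive by the
  obtuse-angle property of projections.\<close>

lemma norm_diff_closest_point_gradient:
  fixes S :: "'a::euclidean_space set"
  assumes "convex S" "closed S" "S \<noteq> {}"
  shows "(norm (y - closest_point S y))\<^sup>2
    \<ge> (norm (x - closest_point S x))\<^sup>2 + 2 * ((x - closest_point S x) \<bullet> (y - x))"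
proof -
  define p q where "p = closest_point S x" and "q = closest_point S y"
  have "(x - p) \<bullet> (q - p) \<le> 0"
    unfolding p_def q_def
    using assms by (intro closest_point_dot closest_point_in_set)
  moreover have "0 \<le> ((y - q) - (x - p)) \<bullet> ((y - q) - (x - p))"
    by (rule inner_ge_zero)
  ultimately have "(norm (y - q))\<^sup>2 \<ge> (norm (x - p))\<^sup>2 + 2 * ((x - p) \<bullet> (y - x))"
    by (simp add: power2_norm_eq_inner inner_diff_left inner_diff_right inner_commute)
  then show ?thesis
    by (simp add: p_def q_def)
qed

text \<open>Parallel axis identity. The cross terms are linear in \<open>p i\<close>, so only the
  sum of the \<open>p i\<close> enters, and the mean condition evaluates it.\<close>

lemma sum_norm_diff_mean:
  fixes p :: "'b \<Rightarrow> 'a::real_inner"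
  assumes mean: "(\<Sum>i\<in>I. p i) = real (card I) *\<^sub>R c"
  shows "(\<Sum>i\<in>I. (norm (c - p i))\<^sup>2)
    = (\<Sum>i\<in>I. (norm (z - p i))\<^sup>2) - real (card I) * (norm (z - c))\<^sup>2"
proof -
  have "(norm (c - p i))\<^sup>2 = (norm (z - p i))\<^sup>2 + (c \<bullet> c - z \<bullet> z) + 2 * ((z - c) \<bullet> p i)" for i
    by (simp add: power2_norm_eq_inner inner_diff_left inner_diff_right inner_commute)
  then have "(\<Sum>i\<in>I. (norm (c - p i))\<^sup>2) = (\<Sum>i\<in>I. (norm (z - p i))\<^sup>2)
      + real (card I) * (c \<bullet> c - z \<bullet> z) + 2 * ((z - c) \<bullet> (\<Sum>i\<in>I. p i))"
    by (simp add: sum.distrib inner_sum_right sum_distrib_left)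
  then show ?thesis
    by (simp add: mean power2_norm_eq_inner inner_commute algebra_simps)
qed

theorem proposition4p4:
  fixes n :: nat
    and C :: "nat \<Rightarrow> (real ^ 'd) set"
    and x0 :: "real ^ 'd"
    and x :: "nat \<Rightarrow> real ^ 'd"
  assumes "n \<ge> 1"
    and "\<And>i. i \<in> {1..n} \<Longrightarrow> C i \<noteq> {}"
    and "\<And>i. i \<in> {1..n} \<Longrightarrow> closed (C i)"
    and "\<And>i. i \<in> {1..n} \<Longrightarrow> convex (C i)"
    and "x 0 = x0"
    and "\<And>k. x (Suc k) = (1 / real n) *\<^sub>R (\<Sum>i = 1..n. closest_point (C i) (x k))"
  shows "self_contracted x"
proof -
  define P where "P i = closest_point (C i)" for i
  define F where "F z = (\<Sum>i = 1..n. (norm (z - P i z))\<^sup>2) / (2 * real n)" for z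
  have mean: "(\<Sum>i = 1..n. P i (x k)) = real n *\<^sub>R x (Suc k)" for k
    using assms(1) by (simp add: assms(6) P_def)
  show ?thesis
  proof (rule self_contracted_gradient_descent[where F = F])
    fix k m
    have "(\<Sum>i = 1..n. (norm (x k - P i (x k)))\<^sup>2 + 2 * ((x k - P i (x k)) \<bullet> (x m - x k)))
        \<le> (\<Sum>i = 1..n. (norm (x m - P i (x m)))\<^sup>2)"
      unfolding P_def using assms(2-4) by (intro sum_mono norm_diff_closest_point_gradient) auto
    moreover have "(\<Sum>i = 1..n. (x k - P i (x k)) \<bullet> (x m - x k))
        = real n * ((x k - x (Suc k)) \<bullet> (x m - x k))"
      by (simp add: inner_sum_left[symmetric] sum_subtractf mean[unfolded One_nat_def]
          inner_diff_left right_diff_distrib)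
    ultimately have "(\<Sum>i = 1..n. (norm (x k - P i (x k)))\<^sup>2)
          + 2 * real n * ((x k - x (Suc k)) \<bullet> (x m - x k))
        \<le> (\<Sum>i = 1..n. (norm (x m - P i (x m)))\<^sup>2)"
      by (simp add: sum.distrib sum_distrib_left[symmetric])
    from divide_right_mono[OF this, of "2 * real n"]
    show "F (x k) + (x k - x (Suc k)) \<bullet> (x m - x k) \<le> F (x m)"
      using assms(1) by (simp add: F_def add_divide_distrib)
  next
    fix k
    \<comment> \<open>The old projections \<open>P i (x k)\<close> serve as competitors in
      \<open>C i\<close>. Their mean is \<open>x (Suc k)\<close>, so the parallel axis identity then
      applies.\<close>
    have "(\<Sum>i = 1..n. (norm (x (Suc k) - P i (x (Suc k))))\<^sup>2)
        \<le> (\<Sum>i = 1..n. (norm (x (Suc k) - P i (x k)))\<^sup>2)"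
    proof (intro sum_mono power_mono norm_ge_zero)
      fix i assume i: "i \<in> {1..n}"
      have "P i (x k) \<in> C i"
        unfolding P_def using assms(2,3) i by (intro closest_point_in_set)
      then show "norm (x (Suc k) - P i (x (Suc k))) \<le> norm (x (Suc k) - P i (x k))"
        using closest_point_le[OF assms(3)[OF i]] by (simp add: P_def dist_norm)
    qed
    also have "\<dots> = (\<Sum>i = 1..n. (norm (x k - P i (x k)))\<^sup>2)
        - real n * (norm (x k - x (Suc k)))\<^sup>2"
      using sum_norm_diff_mean[of "\<lambda>i. P i (x k)" "{1..n}" "x (Suc k)" "x k"] mean by simp
    finally have "(\<Sum>i = 1..n. (norm (x (Suc k) - P i (x (Suc k))))\<^sup>2)
        \<le> (\<Sum>i = 1..n. (norm (x k - P i (x k)))\<^sup>2) - real n * (norm (x k - x (Suc k)))\<^sup>2" .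
    from divide_right_mono[OF this, of "2 * real n"]
    show "F (x (Suc k)) \<le> F (x k) - (norm (x k - x (Suc k)))\<^sup>2 / 2"
      using assms(1) by (simp add: F_def diff_divide_distrib)
  qed
qed

end
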